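(* In the additive Gaussian noise, high signal-to-noise setting of the context, the false alarm density at $x'$ is $$\nu_F(x')=\frac{2\cdot2^{-d/2}}{\Gamma(d/2)}\,\frac{r'^{\,d}}{V(x')}\,e^{-\zeta r'^2/2}\int_0^\infty G\big(z_r(u)\big)\,e^{-u^2}u^{d-1}\,du,$$ where $r'=r(x')$, $G(t)=\frac1{\sqrt{2\pi}}\int_t^\infty e^{-z^2/2}dz$, and $$z_r(u)=\frac{(1+\gamma)^{1/2}}{r'}\left(\lambda_r(x')-\left[\frac12\,\frac{\gamma-1}{\gamma+1}\,r'^2+\frac12u^2\right]\right).$$
   Context: Measurement model: $\mathbf m=\mathbf s(x)+\mathbf n$, where $\mathbf n$ is Gaussian of mean zero and (positive definite) covariance $\mathbf C$. Here $\mathbf s(x)$ is a known smooth family of nonzero signals, $x$ in a $d$-dimensional continuous domain $\chi$. "No signal" has prior probability $a_0>0$ and signal parameters have prior density $a(x)>0$. $C(x')>0$ is the cost of a false alarm at $x'$. An asterisk denotes transpose. Amplitude SNR: $r(x)=(\mathbf s^*(x)\mathbf C^{-1}\mathbf s(x))^{1/2}>0$. Log-likelihood ratio $\lambda(x')=\mathbf s^*(x')\mathbf C^{-1}\mathbf m-\frac12r^2(x')$. Normalized filter output $y(x)=\mathbf s^*(x)\mathbf C^{-1}\mathbf m/r(x)$. Curvature matrix $M_{ij}=\langle\frac{\partial y}{\partial x_i}\frac{\partial y}{\partial x_j}\rangle$ for noise only, assumed positive definite. $Q=M+\frac{\nabla r}{r}\frac{\nabla r^*}{r}$. Volume scale $V(x')=[\det(Q(x')/2\pi)]^{-1/2}$.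 Inhomogeneity parameters (evaluated at $x'$) $$\gamma=\frac{\nabla r^*}{r}M^{-1}\frac{\nabla r}{r},\qquad \zeta=\frac{\nabla r^*}{r}Q^{-1}\frac{\nabla r}{r}=\frac{\gamma}{1+\gamma}.$$ A signal is declared at a local maximum $x'$ of $\lambda$ when $\lambda(x')$ exceeds the threshold $$\lambda_r(x')=\log\left[\frac{a_0C(x')r^d(x')}{a(x')V(x')}\right].$$ False alarm density: $\nu_F(x')$ is the density over $x'$ of false detections at $x'$ when no signal is present. In the high-SNR limit, with prior, cost and geometric quantities constant over a likelihood peak, it is related to detections by $$\nu_F(x')=\frac{r'^{\,d}}{V(x')}\int_{\mathbb R^d}\int_{\lambda_r(x')}^\infty e^{-\lambda'}\,p_D(\lambda',x'|x)\,d\lambda'\,dx .$$ Here $p_D(\lambda',x'|x)$ is the joint density of the peak log-likelihood value $\lambda'$ and the peak location $x'$ produced by a signal at $x$. It factors as $p_D(\lambda',x'|x)=p_D(\lambda'|x',x)\,p_{x'}(x'|x)$. In the high-SNR Gaussian limit (with $r(x)$ replaced by $r'=r(x')$ in the variances and all geometric quantities evaluated at $x'$) $$p_D(\lambda'|x',x)=\frac{\sqrt{1+\gamma}}{\sqrt{2\pi}\,r'}\exp\left(-\frac{1+\gamma}{2r'^2}\Big[\lambda'-\tfrac12r'^2-b\Big]^2\right),$$ $$p_{x'}(x'|x)=\frac{r'^{\,d}(\det Q)^{1/2}}{(2\pi)^{d/2}}\,e^{-b},\qquad b=\tfrac12(x'-x)^*\,r'^2Q\,(x'-x).$$ *)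

theory Defs
  imports "HOL-Probability.Probability"
begin

definition pos_def :: "real^'k^'k \<Rightarrow> bool" where
  "pos_def A \<longleftrightarrow> transpose A = A \<and> (\<forall>v. v \<noteq> 0 \<longrightarrow> 0 < v \<bullet> (A *v v))"

definition gradient :: "(real^'d \<Rightarrow> real) \<Rightarrow> real^'d \<Rightarrow> real^'d" where
  "gradient f x = (\<chi> i. frechet_derivative f (at x) (axis i 1))"

text \<open>On an open set, \<open>diff_on_order k\<close> is \<open>k\<close>-fold continuous differentiability,
  expressed through iterated directional derivatives.\<close>

primrec diff_on_order ::
    "nat \<Rightarrow> ('a::real_normed_vector) set \<Rightarrow> ('a \<Rightarrow> 'b::real_normed_vector) \<Rightarrow> bool" where
  "diff_on_order 0 X f \<longleftrightarrow> continuous_on X f"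
| "diff_on_order (Suc k) X f \<longleftrightarrow> (\<forall>x\<in>X. f differentiable at x) \<and>
     (\<forall>v. diff_on_order k X (\<lambda>x. frechet_derivative f (at x) v))"

definition smooth_on :: "('a::real_normed_vector) set \<Rightarrow> ('a \<Rightarrow> 'b::real_normed_vector) \<Rightarrow> bool" where
  "smooth_on X f \<longleftrightarrow> (\<forall>k. diff_on_order k X f)"

text \<open>The law \<open>N(0, Cov)\<close> of the noise, which is also the law of the data when no signal is present.\<close>

definition gaussian_noise :: "real^'n^'n \<Rightarrow> (real^'n) measure" where
  "gaussian_noise Cov = density lborel
     (\<lambda>z. ennreal (exp (- (z \<bullet> (matrix_inv Cov *v z)) / 2) / sqrt (det ((2 * pi) *\<^sub>R Cov))))"

definition snr :: "(real^'d \<Rightarrow> real^'n) \<Rightarrow> real^'n^'n \<Rightarrow> real^'d \<Rightarrow> real" where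
  "snr s Cov x = sqrt (s x \<bullet> (matrix_inv Cov *v s x))"

definition log_lr :: "(real^'d \<Rightarrow> real^'n) \<Rightarrow> real^'n^'n \<Rightarrow> real^'n \<Rightarrow> real^'d \<Rightarrow> real" where
  "log_lr s Cov m x = s x \<bullet> (matrix_inv Cov *v m) - (snr s Cov x)\<^sup>2 / 2"

definition filter_output :: "(real^'d \<Rightarrow> real^'n) \<Rightarrow> real^'n^'n \<Rightarrow> real^'n \<Rightarrow> real^'d \<Rightarrow> real" where
  "filter_output s Cov m x = (s x \<bullet> (matrix_inv Cov *v m)) / snr s Cov x"

definition curvature :: "(real^'d \<Rightarrow> real^'n) \<Rightarrow> real^'n^'n \<Rightarrow> real^'d \<Rightarrow> real^'d^'d" where
  "curvature s Cov x = (\<chi> i j. \<integral>m. gradient (filter_output s Cov m) x $ i *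
     gradient (filter_output s Cov m) x $ j \<partial>gaussian_noise Cov)"

text \<open>The vector \<open>\<nabla>r / r\<close>.\<close>

definition rel_grad :: "(real^'d \<Rightarrow> real^'n) \<Rightarrow> real^'n^'n \<Rightarrow> real^'d \<Rightarrow> real^'d" where
  "rel_grad s Cov x = gradient (snr s Cov) x /\<^sub>R snr s Cov x"

definition Qmat :: "(real^'d \<Rightarrow> real^'n) \<Rightarrow> real^'n^'n \<Rightarrow> real^'d \<Rightarrow> real^'d^'d" where
  "Qmat s Cov x = curvature s Cov x + (\<chi> i j. rel_grad s Cov x $ i * rel_grad s Cov x $ j)"

definition volume_scale :: "(real^'d \<Rightarrow> real^'n) \<Rightarrow> real^'n^'n \<Rightarrow> real^'d \<Rightarrow> real" where
  "volume_scale s Cov x = det (Qmat s Cov x /\<^sub>R (2 * pi)) powr (- 1 / 2)"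

definition gamma_par :: "(real^'d \<Rightarrow> real^'n) \<Rightarrow> real^'n^'n \<Rightarrow> real^'d \<Rightarrow> real" where
  "gamma_par s Cov x = rel_grad s Cov x \<bullet> (matrix_inv (curvature s Cov x) *v rel_grad s Cov x)"

definition zeta_par :: "(real^'d \<Rightarrow> real^'n) \<Rightarrow> real^'n^'n \<Rightarrow> real^'d \<Rightarrow> real" where
  "zeta_par s Cov x = rel_grad s Cov x \<bullet> (matrix_inv (Qmat s Cov x) *v rel_grad s Cov x)"

text \<open>In the following, \<open>a0\<close> is the prior probability of no signal, \<open>a\<close> the prior density of the
  signal parameters and \<open>cost\<close> the cost of a false alarm.\<close>

definition threshold :: "(real^'d \<Rightarrow> real^'n) \<Rightarrow> real^'n^'n \<Rightarrow> real \<Rightarrow> (real^'d \<Rightarrow> real) \<Rightarrow>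
    (real^'d \<Rightarrow> real) \<Rightarrow> real^'d \<Rightarrow> real" where
  "threshold s Cov a0 a cost x =
     ln (a0 * cost x * snr s Cov x ^ CARD('d) / (a x * volume_scale s Cov x))"

definition declared :: "(real^'d) set \<Rightarrow> (real^'d \<Rightarrow> real^'n) \<Rightarrow> real^'n^'n \<Rightarrow> real \<Rightarrow>
    (real^'d \<Rightarrow> real) \<Rightarrow> (real^'d \<Rightarrow> real) \<Rightarrow> real^'n \<Rightarrow> real^'d \<Rightarrow> bool" where
  "declared X s Cov a0 a cost m x \<longleftrightarrow> x \<in> X \<and>
     (\<forall>\<^sub>F z in at x within X. log_lr s Cov m z \<le> log_lr s Cov m x) \<and>
     threshold s Cov a0 a cost x < log_lr s Cov m x"

text \<open>\<open>nu\<close> is a density of the expected number of declared signals when the data are pure noise.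
  As a density it is determined only almost everywhere.\<close>

definition false_alarm_density :: "(real^'d) set \<Rightarrow> (real^'d \<Rightarrow> real^'n) \<Rightarrow> real^'n^'n \<Rightarrow> real \<Rightarrow>
    (real^'d \<Rightarrow> real) \<Rightarrow> (real^'d \<Rightarrow> real) \<Rightarrow> (real^'d \<Rightarrow> real) \<Rightarrow> bool" where
  "false_alarm_density X s Cov a0 a cost nu \<longleftrightarrow>
     set_borel_measurable lborel X nu \<and> (\<forall>x\<in>X. 0 \<le> nu x) \<and>
     (\<forall>A\<in>sets borel. A \<subseteq> X \<longrightarrow>
       (\<integral>\<^sup>+m. emeasure (count_space UNIV) {x\<in>A. declared X s Cov a0 a cost m x}
          \<partial>gaussian_noise Cov) = (\<integral>\<^sup>+x\<in>A. ennreal (nu x) \<partial>lborel))"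

text \<open>High signal-to-noise densities of the peak value \<open>l\<close> and peak location \<open>x'\<close> for a signal
  at \<open>x\<close>; the signal-to-noise ratio and all geometric quantities are evaluated at \<open>x'\<close>.\<close>

definition displacement_par :: "(real^'d \<Rightarrow> real^'n) \<Rightarrow> real^'n^'n \<Rightarrow> real^'d \<Rightarrow> real^'d \<Rightarrow> real" where
  "displacement_par s Cov x' x =
     ((x' - x) \<bullet> (((snr s Cov x')\<^sup>2 *\<^sub>R Qmat s Cov x') *v (x' - x))) / 2"

definition peak_value_density ::
    "(real^'d \<Rightarrow> real^'n) \<Rightarrow> real^'n^'n \<Rightarrow> real \<Rightarrow> real^'d \<Rightarrow> real^'d \<Rightarrow> real" where
  "peak_value_density s Cov l x' x =
     sqrt (1 + gamma_par s Cov x') / (sqrt (2 * pi) * snr s Cov x') *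
     exp (- ((1 + gamma_par s Cov x') / (2 * (snr s Cov x')\<^sup>2)) *
       (l - (snr s Cov x')\<^sup>2 / 2 - displacement_par s Cov x' x)\<^sup>2)"

definition peak_location_density ::
    "(real^'d \<Rightarrow> real^'n) \<Rightarrow> real^'n^'n \<Rightarrow> real^'d \<Rightarrow> real^'d \<Rightarrow> real" where
  "peak_location_density s Cov x' x =
     snr s Cov x' ^ CARD('d) * sqrt (det (Qmat s Cov x')) / (2 * pi) powr (real CARD('d) / 2) *
     exp (- displacement_par s Cov x' x)"

definition peak_density ::
    "(real^'d \<Rightarrow> real^'n) \<Rightarrow> real^'n^'n \<Rightarrow> real \<Rightarrow> real^'d \<Rightarrow> real^'d \<Rightarrow> real" where
  "peak_density s Cov l x' x = peak_value_density s Cov l x' x * peak_location_density s Cov x' x"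

definition gauss_tail :: "real \<Rightarrow> real" where
  "gauss_tail t = 1 / sqrt (2 * pi) * (LINT z:{t..}|lborel. exp (- z\<^sup>2 / 2))"

definition scaled_threshold :: "(real^'d \<Rightarrow> real^'n) \<Rightarrow> real^'n^'n \<Rightarrow> real \<Rightarrow> (real^'d \<Rightarrow> real) \<Rightarrow>
    (real^'d \<Rightarrow> real) \<Rightarrow> real^'d \<Rightarrow> real \<Rightarrow> real" where
  "scaled_threshold s Cov a0 a cost x' u =
     sqrt (1 + gamma_par s Cov x') / snr s Cov x' *
     (threshold s Cov a0 a cost x' -
       (1 / 2 * ((gamma_par s Cov x' - 1) / (gamma_par s Cov x' + 1)) * (snr s Cov x')\<^sup>2 + u\<^sup>2 / 2))"

end

theory Submission imports Defs begin

text \<open>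
  The relation between the false alarm density and the peak densities is a double integral over the
  peak value \<open>l\<close> and the signal position \<open>x\<close>, and both integrations can be done exactly.

  For fixed \<open>x\<close>, the peak value is normal with mean \<open>\<mu> = r\<^sup>2 / 2 + b\<close> and variance
  \<open>\<sigma>\<^sup>2 = r\<^sup>2 / (1 + \<gamma>)\<close>, where \<open>b\<close> is the displacement parameter. The weight \<open>exp (- l)\<close> shifts the mean
  by \<open>- \<sigma>\<^sup>2\<close> and contributes the factor \<open>exp (\<sigma>\<^sup>2 / 2 - \<mu>)\<close> (\<open>exp_normal_tail_integral\<close>). Since
  \<open>\<zeta> = \<gamma> / (1 + \<gamma>)\<close> (\<open>rank_one_update_inverse_form\<close>), that factor is \<open>exp (- \<zeta> * r\<^sup>2 / 2) * exp (- b)\<close>, and the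
  tail is a Gaussian tail at the scaled threshold.

  What remains depends on \<open>x\<close> only through \<open>b = u\<^sup>2 / 2\<close>, where \<open>u\<close> is the distance from \<open>x'\<close> to \<open>x\<close>
  in the metric \<open>r\<^sup>2 *\<^sub>R Q\<close>. The balls of that metric are ellipsoids of known volume (\<open>emeasure_ellipsoid\<close>),
  so the integral over \<open>x\<close> is one over \<open>u\<close> with density proportional to \<open>u ^ (d - 1)\<close>
  (\<open>integral_of_quadratic_form\<close>). The factor \<open>exp (- b)\<close> above and the one of the peak location
  density combine to \<open>exp (- u\<^sup>2)\<close>, the determinant cancels, and the area of the unit sphere leaves
  the constant with the Gamma function.
\<close>

section \<open>Exponentially weighted Gaussian tails\<close>

text \<open>Tilting a normal density by \<open>exp (- l)\<close> gives, after completing the square, a multiple of the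
  normal density with the same variance and mean shifted down by \<open>\<sigma>\<^sup>2\<close>; the multiple is
  the Laplace transform \<open>exp (\<sigma>\<^sup>2 / 2 - \<mu>)\<close>.\<close>

lemma exp_normal_tail_integral:
  fixes \<sigma> \<mu> \<tau> :: real
  assumes "0 < \<sigma>"
  shows "(LINT l:{\<tau>..}|lborel. exp (- l) * (1 / (sqrt (2 * pi) * \<sigma>) * exp (- (1 / (2 * \<sigma>\<^sup>2)) * (l - \<mu>)\<^sup>2)))
    = exp (\<sigma>\<^sup>2 / 2 - \<mu>) * gauss_tail ((\<tau> - (\<mu> - \<sigma>\<^sup>2)) / \<sigma>)"
proof -
  \<comment> \<open>The substitution \<open>l = \<mu> - \<sigma>\<^sup>2 + \<sigma> * z\<close> standardizes the shifted density.\<close>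
  have integrand: "\<sigma> * (indicator {\<tau>..} (\<mu> - \<sigma>\<^sup>2 + \<sigma> * z) * (exp (- (\<mu> - \<sigma>\<^sup>2 + \<sigma> * z)) *
        (1 / (sqrt (2 * pi) * \<sigma>) * exp (- (1 / (2 * \<sigma>\<^sup>2)) * (\<mu> - \<sigma>\<^sup>2 + \<sigma> * z - \<mu>)\<^sup>2))))
      = exp (\<sigma>\<^sup>2 / 2 - \<mu>) / sqrt (2 * pi) *
        (indicator {(\<tau> - (\<mu> - \<sigma>\<^sup>2)) / \<sigma>..} z * exp (- z\<^sup>2 / 2))" for z
  proof -
    have ind: "indicator {\<tau>..} (\<mu> - \<sigma>\<^sup>2 + \<sigma> * z) = (indicator {(\<tau> - (\<mu> - \<sigma>\<^sup>2)) / \<sigma>..} z :: real)"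
      using assms by (auto simp: indicator_def field_simps)
    have "\<mu> - \<sigma>\<^sup>2 + \<sigma> * z - \<mu> = \<sigma> * (z - \<sigma>)"
      by (simp add: algebra_simps power2_eq_square)
    then have "- (1 / (2 * \<sigma>\<^sup>2)) * (\<mu> - \<sigma>\<^sup>2 + \<sigma> * z - \<mu>)\<^sup>2 = - (z - \<sigma>)\<^sup>2 / 2"
      using assms by (simp add: power_mult_distrib)
    moreover have "- (\<mu> - \<sigma>\<^sup>2 + \<sigma> * z) + - (z - \<sigma>)\<^sup>2 / 2 = (\<sigma>\<^sup>2 / 2 - \<mu>) + - z\<^sup>2 / 2"
      by (simp add: power2_eq_square field_simps)
    ultimately have "exp (- (\<mu> - \<sigma>\<^sup>2 + \<sigma> * z)) * exp (- (1 / (2 * \<sigma>\<^sup>2)) * (\<mu> - \<sigma>\<^sup>2 + \<sigma> * z - \<mu>)\<^sup>2)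
        = exp (\<sigma>\<^sup>2 / 2 - \<mu>) * exp (- z\<^sup>2 / 2)"
      by (metis exp_add)
    then show ?thesis
      unfolding ind using assms by (simp add: field_simps)
  qed
  have "(LINT l:{\<tau>..}|lborel. exp (- l) * (1 / (sqrt (2 * pi) * \<sigma>) * exp (- (1 / (2 * \<sigma>\<^sup>2)) * (l - \<mu>)\<^sup>2)))
    = (LINT z|lborel. \<sigma> * (indicator {\<tau>..} (\<mu> - \<sigma>\<^sup>2 + \<sigma> * z) * (exp (- (\<mu> - \<sigma>\<^sup>2 + \<sigma> * z)) *
        (1 / (sqrt (2 * pi) * \<sigma>) * exp (- (1 / (2 * \<sigma>\<^sup>2)) * (\<mu> - \<sigma>\<^sup>2 + \<sigma> * z - \<mu>)\<^sup>2)))))"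
    unfolding set_lebesgue_integral_def real_scaleR_def
    using assms by (subst lborel_integral_real_affine[where c=\<sigma> and t="\<mu> - \<sigma>\<^sup>2"]) simp_all
  then show ?thesis
    unfolding integrand gauss_tail_def set_lebesgue_integral_def by simp
qed

lemma borel_measurable_gauss_tail [measurable]: "gauss_tail \<in> borel_measurable borel"
proof -
  have "(\<lambda>t. 1 / sqrt (2 * pi) * (LINT z|lborel. (if t \<le> z then exp (- z\<^sup>2 / 2) else 0)))
      \<in> borel_measurable borel"
    by measurable
  also have "(\<lambda>t. 1 / sqrt (2 * pi) * (LINT z|lborel. (if t \<le> z then exp (- z\<^sup>2 / 2) else 0))) = gauss_tail"
    unfolding gauss_tail_def set_lebesgue_integral_def
    by (intro ext arg_cong2[where f="(*)"] refl Bochner_Integration.integral_cong)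
      (auto simp: indicator_def)
  finally show ?thesis .
qed

section \<open>Positive definite matrices and rank one updates\<close>

lemma pos_def_invertible:
  fixes A :: "real^'k^'k"
  assumes "pos_def A" shows "invertible A"
proof -
  have "x = 0" if "A *v x = 0" for x
    using assms that unfolding pos_def_def by (metis inner_zero_right less_irrefl)
  then show ?thesis
    by (auto simp: invertible_left_inverse matrix_left_invertible_ker)
qed

lemma matrix_inv_mult:
  fixes A :: "real^'k^'k"
  assumes "invertible A"
  shows "A ** matrix_inv A = mat 1" "matrix_inv A ** A = mat 1"
proof -
  have "\<exists>A'. A ** A' = mat 1 \<and> A' ** A = mat 1"
    using assms by (simp add: invertible_def)
  then have "A ** matrix_inv A = mat 1 \<and> matrix_inv A ** A = mat 1"
    unfolding matrix_inv_def by (rule someI_ex)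
  then show "A ** matrix_inv A = mat 1" "matrix_inv A ** A = mat 1" by auto
qed

lemma pos_def_matrix_inv_pos:
  fixes A :: "real^'k^'k"
  assumes "pos_def A" "v \<noteq> 0"
  shows "0 < v \<bullet> (matrix_inv A *v v)"
proof -
  define w where "w = matrix_inv A *v v"
  have v: "v = A *v w"
    by (simp add: w_def matrix_vector_mul_assoc matrix_inv_mult pos_def_invertible assms)
  then have "w \<noteq> 0" using assms(2) by auto
  then have "0 < w \<bullet> (A *v w)" using assms(1) by (simp add: pos_def_def)
  then show ?thesis by (metis inner_commute v w_def)
qed

lemma pos_def_symmetric_form:
  fixes A :: "real^'k^'k"
  assumes "pos_def A"
  shows "u \<bullet> (A *v v) = (A *v u) \<bullet> v"
  using assms by (metis dot_lmul_matrix pos_def_def transpose_matrix_vector)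

text \<open>Gram-Schmidt for the inner product \<open>u \<bullet> (A *v v)\<close>: as long as fewer than \<open>CARD('k)\<close> vectors
  have been found, their images under \<open>A\<close> do not span, so some nonzero vector is orthogonal to all
  of the images and can be normalized.\<close>

lemma pos_def_orthonormal_set:
  fixes A :: "real^'k^'k"
  assumes "pos_def A" "n \<le> CARD('k)"
  shows "\<exists>S. finite S \<and> card S = n \<and> (\<forall>u\<in>S. \<forall>v\<in>S. u \<bullet> (A *v v) = (if u = v then 1 else 0))"
  using assms(2)
proof (induction n)
  case (Suc n)
  then obtain S where S: "finite S" "card S = n"
    "\<And>u v. u \<in> S \<Longrightarrow> v \<in> S \<Longrightarrow> u \<bullet> (A *v v) = (if u = v then 1 else 0)"
    by auto
  have "dim ((*v) A ` S) \<le> n"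
    using S(1,2) by (metis card_image_le dim_le_card' finite_imageI le_trans)
  then have "dim ((*v) A ` S) < DIM(real^'k)"
    using Suc.prems by simp
  then obtain x where x: "x \<noteq> 0" "\<And>y. y \<in> span ((*v) A ` S) \<Longrightarrow> orthogonal x y"
    using orthogonal_to_subspace_exists by blast
  define w where "w = x /\<^sub>R sqrt (x \<bullet> (A *v x))"
  have "0 < x \<bullet> (A *v x)"
    using assms(1) x(1) by (simp add: pos_def_def)
  then have ww: "w \<bullet> (A *v w) = 1"
    by (simp add: w_def matrix_vector_mult_scaleR field_simps)
  have ws: "w \<bullet> (A *v s) = 0" if "s \<in> S" for s
    using x(2)[of "A *v s"] that by (simp add: w_def orthogonal_def span_base)
  then have sw: "s \<bullet> (A *v w) = 0" if "s \<in> S" for s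
    using that by (metis assms(1) inner_commute pos_def_symmetric_form)
  have "w \<notin> S" using ws ww by force
  with S ww ws sw show ?case
    by (intro exI[of _ "insert w S"]) auto
qed (auto intro!: exI[of _ "{}"])

text \<open>The columns of \<open>B\<close> are an orthonormal basis for the inner product given by \<open>A\<close>. Such a \<open>B\<close>
  takes the place of the inverse square root of \<open>A\<close> in the substitution that turns ellipsoids into balls.\<close>

lemma pos_def_congruent_identity:
  fixes A :: "real^'k^'k"
  assumes "pos_def A"
  obtains B :: "real^'k^'k" where "transpose B ** A ** B = mat 1"
proof -
  obtain S where S: "finite S" "card S = CARD('k)"
    "\<And>u v. u \<in> S \<Longrightarrow> v \<in> S \<Longrightarrow> u \<bullet> (A *v v) = (if u = v then 1 else 0)"
    using pos_def_orthonormal_set[OF assms order_refl] by metis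
  obtain f :: "'k \<Rightarrow> real^'k" where f: "bij_betw f UNIV S"
    using S(1,2) by (metis finite_class.finite_UNIV finite_same_card_bij)
  define B :: "real^'k^'k" where "B = (\<chi> i j. f j $ i)"
  have col: "B *v axis j 1 = f j" for j
    by (simp add: B_def matrix_vector_mult_basis column_def)
  have "(transpose B ** A ** B) $ i $ j = mat 1 $ i $ j" for i j
  proof -
    have "(transpose B ** A ** B) $ i $ j = axis i 1 \<bullet> ((transpose B ** A ** B) *v axis j 1)"
      by (simp add: matrix_vector_mult_basis inner_axis' column_def)
    also have "\<dots> = (B *v axis i 1) \<bullet> (A *v (B *v axis j 1))"
      by (simp add: matrix_vector_mul_assoc[symmetric] dot_lmul_matrix[symmetric]
          vector_transpose_matrix del: transpose_matrix_vector)
    also have "\<dots> = (if f i = f j then 1 else 0)"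
      unfolding col using f by (intro S(3)) (auto simp: bij_betw_def)
    also have "\<dots> = mat 1 $ i $ j"
      using f by (auto simp: mat_def bij_betw_def inj_eq)
    finally show ?thesis .
  qed
  then show thesis
    by (intro that[of B]) (simp add: vec_eq_iff)
qed

lemma rank_one_update_mult:
  fixes M :: "real^'k^'k" and g :: "real^'k"
  shows "(M + (\<chi> i j. g $ i * g $ j)) *v v = M *v v + (g \<bullet> v) *\<^sub>R g"
  by (simp add: vec_eq_iff matrix_vector_mult_def inner_vec_def sum.distrib
      distrib_right sum_distrib_left mult_ac distrib_left)

lemma pos_def_rank_one_update:
  fixes M :: "real^'k^'k" and g :: "real^'k"
  assumes "pos_def M"
  shows "pos_def (M + (\<chi> i j. g $ i * g $ j))"
  unfolding pos_def_def
proof safe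
  show "transpose (M + (\<chi> i j. g $ i * g $ j)) = M + (\<chi> i j. g $ i * g $ j)"
    using assms by (auto simp: pos_def_def transpose_def vec_eq_iff)
  fix v :: "real^'k" assume "v \<noteq> 0"
  then have "0 < v \<bullet> (M *v v)" using assms by (simp add: pos_def_def)
  then show "0 < v \<bullet> ((M + (\<chi> i j. g $ i * g $ j)) *v v)"
    by (simp add: rank_one_update_mult inner_add_right inner_commute add_pos_nonneg)
qed

text \<open>The Sherman-Morrison formula evaluated on the updating vector itself: with \<open>h\<close> the solution of
  \<open>M *v h = g\<close>, the updated matrix maps \<open>h\<close> to \<open>(1 + \<gamma>) *\<^sub>R g\<close>. For \<open>M\<close> the curvature matrix and \<open>g\<close>
  the relative gradient of the signal-to-noise ratio, it says \<open>\<zeta> = \<gamma> / (1 + \<gamma>)\<close>.\<close>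

lemma rank_one_update_inverse_form:
  fixes M :: "real^'k^'k" and g :: "real^'k"
  assumes "pos_def M"
  defines "\<gamma> \<equiv> g \<bullet> (matrix_inv M *v g)"
  shows "0 \<le> \<gamma>"
    and "g \<bullet> (matrix_inv (M + (\<chi> i j. g $ i * g $ j)) *v g) = \<gamma> / (1 + \<gamma>)"
proof -
  show nonneg: "0 \<le> \<gamma>"
    using pos_def_matrix_inv_pos[OF assms(1), of g] by (cases "g = 0") (auto simp: \<gamma>_def)
  define Q where "Q = M + (\<chi> i j. g $ i * g $ j)"
  define h where "h = matrix_inv M *v g"
  have "M *v h = g"
    by (simp add: h_def matrix_vector_mul_assoc matrix_inv_mult pos_def_invertible assms(1))
  then have "Q *v h = (1 + \<gamma>) *\<^sub>R g"
    by (simp add: Q_def rank_one_update_mult \<gamma>_def h_def scaleR_left_distrib)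
  then have "matrix_inv Q *v ((1 + \<gamma>) *\<^sub>R g) = h"
    using matrix_inv_mult(2)[OF pos_def_invertible, of Q] pos_def_rank_one_update[OF assms(1)]
    by (metis Q_def matrix_vector_mul_assoc matrix_vector_mul_lid)
  then have "(1 + \<gamma>) * (g \<bullet> (matrix_inv Q *v g)) = \<gamma>"
    by (metis \<gamma>_def h_def inner_scaleR_right matrix_vector_mult_scaleR)
  then show "g \<bullet> (matrix_inv (M + (\<chi> i j. g $ i * g $ j)) *v g) = \<gamma> / (1 + \<gamma>)"
    using nonneg by (simp add: Q_def field_simps)
qed

lemma det_scaleR_matrix:
  fixes A :: "real^'k^'k"
  shows "det (c *\<^sub>R A) = c ^ CARD('k) * det A"
proof -
  have "c *\<^sub>R A = (\<chi> i. c *s row i A)"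
    by (simp add: vec_eq_iff row_def)
  then show ?thesis
    by (simp add: det_rows_mul row_def)
qed

section \<open>Volumes of ellipsoids\<close>

text \<open>A linear map is a product of stretches, coordinate swaps, shears and degenerate maps, and the
  determinant is multiplicative. The argument uses no order on the coordinates, so that, unlike
  \<open>measure_linear_image\<close>, the lemma applies to any finite index type.\<close>

lemma measure_linear_image_cart:
  fixes f :: "real^'n \<Rightarrow> real^'n"
  assumes "linear f" "S \<in> lmeasurable"
  shows "f ` S \<in> lmeasurable \<and> measure lebesgue (f ` S) = \<bar>det (matrix f)\<bar> * measure lebesgue S"
proof -
  let ?P = "\<lambda>h :: real^'n \<Rightarrow> real^'n. \<forall>S \<in> lmeasurable. h ` S \<in> lmeasurable \<and>
      measure lebesgue (h ` S) = \<bar>det (matrix h)\<bar> * measure lebesgue S"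
  \<comment> \<open>For the swaps and shears it is enough to look at boxes with a corner at the origin: linearity
    turns a translation of the box into a translation of its image.\<close>
  have volume_preserving: "?P h"
    if "linear h" "\<bar>det (matrix h)\<bar> = 1"
      "\<And>b. 0 \<le> b \<Longrightarrow> measure lebesgue (h ` cbox 0 b) = measure lebesgue (cbox 0 b)"
    for h :: "real^'n \<Rightarrow> real^'n"
  proof
    fix S :: "(real^'n) set"
    assume S: "S \<in> lmeasurable"
    have "measure lebesgue (h ` cbox a b) = 1 * measure lebesgue (cbox a b)" for a b
    proof (cases "cbox a b = {}")
      case False
      then have "0 \<le> b - a"
        by (simp add: interval_ne_empty_cart less_eq_vec_def)
      have "cbox a b = (+) a ` cbox 0 (b - a)"
        by (simp add: cbox_translation[symmetric])
      moreover from this have "h ` cbox a b = (+) (h a) ` h ` cbox 0 (b - a)"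
        by (simp add: image_image linear_add[OF \<open>linear h\<close>])
      ultimately show ?thesis
        using that(3)[OF \<open>0 \<le> b - a\<close>] by (simp only: measure_translation mult_1)
    qed simp
    then show "h ` S \<in> lmeasurable \<and> measure lebesgue (h ` S) = \<bar>det (matrix h)\<bar> * measure lebesgue S"
      using measure_linear_sufficient[OF \<open>linear h\<close> S, of 1] that(2) by simp
  qed
  have "?P f"
  proof (rule induct_linear_elementary[OF \<open>linear f\<close>])
    fix f g :: "real^'n \<Rightarrow> real^'n"
    assume "linear f" "linear g"
      "?P f" "?P g"
    then show "?P (f \<circ> g)"
      unfolding image_comp[symmetric] by (simp add: matrix_compose det_mul abs_mult)
  next
    fix f :: "real^'n \<Rightarrow> real^'n" and i
    assume f: "linear f" "\<And>x. f x $ i = 0"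
    have "\<not> surj f"
      using f(2) by (metis one_neq_zero surjE vec_component)
    then have "\<not> inj f"
      using f(1) linear_injective_imp_surjective by blast
    then have "det (matrix f) = 0" "\<And>S. negligible (f ` S)"
      using f(1) det_nz_iff_inj[OF f(1)] negligible_linear_singular_image by blast+
    then show "?P f"
      by (simp add: negligible_iff_measure)
  next
    fix c :: "'n \<Rightarrow> real"
    have "matrix (\<lambda>x::real^'n. \<chi> i. c i * x $ i) = (\<chi> i j. if i = j then c i else 0)"
      by (simp add: matrix_def axis_def vec_eq_iff)
    then have "det (matrix (\<lambda>x::real^'n. \<chi> i. c i * x $ i)) = prod c UNIV"
      by (simp add: det_diagonal)
    then show "\<forall>S \<in> lmeasurable. (\<lambda>x. \<chi> i. c i * x $ i) ` S \<in> lmeasurable \<and>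
        measure lebesgue ((\<lambda>x. \<chi> i. c i * x $ i) ` S) = \<bar>det (matrix (\<lambda>x::real^'n. \<chi> i. c i * x $ i))\<bar> * measure lebesgue S"
      by (simp add: measurable_stretch measure_stretch)
  next
    fix m n :: 'n
    assume "m \<noteq> n"
    let ?p = "Transposition.transpose m n"
    let ?h = "\<lambda>x::real^'n. \<chi> i. x $ ?p i"
    have h: "linear ?h"
      by (rule linearI) (simp_all add: vec_eq_iff)
    have "matrix ?h = (\<chi> i. mat 1 $ ?p i)"
      by (auto simp: matrix_def mat_def axis_def vec_eq_iff)
    then have "\<bar>det (matrix ?h)\<bar> = 1"
      by (simp add: det_permute_rows permutes_swap_id sign_swap_id abs_mult)
    moreover have "measure lebesgue (?h ` cbox 0 b) = measure lebesgue (cbox 0 b)" if "0 \<le> b" for b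
    proof -
      have "?h ` cbox 0 b = cbox 0 (?h b)"
      proof (intro equalityI subsetI)
        fix x assume "x \<in> cbox 0 (?h b)"
        then have "?h x \<in> cbox 0 b"
          by (auto simp: mem_box_cart) (metis transpose_involutory)+
        moreover have "x = ?h (?h x)" by (simp add: vec_eq_iff)
        ultimately show "x \<in> ?h ` cbox 0 b" by blast
      qed (auto simp: mem_box_cart)
      moreover have "(\<Prod>i\<in>UNIV. b $ ?p i) = (\<Prod>i\<in>UNIV. b $ i)"
        using prod.permute[OF permutes_swap_id, of m UNIV n "\<lambda>i. b $ i"] by (simp add: o_def)
      moreover have "0 \<le> ?h b"
        using that by (simp add: less_eq_vec_def)
      ultimately show ?thesis
        using that by (simp add: content_cbox_if_cart interval_eq_empty_cart less_eq_vec_def not_less)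
          (metis not_less)
    qed
    ultimately show "?P ?h"
      using volume_preserving[OF h] by blast
  next
    fix m n :: 'n
    assume "m \<noteq> n"
    let ?h = "\<lambda>x::real^'n. \<chi> i. if i = m then x $ m + x $ n else x $ i"
    have h: "linear ?h"
      by (rule linearI) (auto simp: vec_eq_iff algebra_simps)
    \<comment> \<open>Reading the shear as a row operation on the identity gives its determinant without an order
      on the indices, which triangularity would need.\<close>
    have "matrix ?h = (\<chi> k. if k = m then row m (mat 1) + 1 *s row n (mat 1) else row k (mat 1))"
      using \<open>m \<noteq> n\<close> by (auto simp: matrix_def mat_def axis_def row_def vec_eq_iff)
    then have "\<bar>det (matrix ?h)\<bar> = 1"
      by (simp only: det_row_operation[OF \<open>m \<noteq> n\<close>] det_I abs_one)
    moreover have "measure lebesgue (?h ` cbox 0 b) = measure lebesgue (cbox 0 b)" if "0 \<le> b" for b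
      using that by (intro measure_shear_interval[OF \<open>m \<noteq> n\<close>])
        (auto simp: interval_ne_empty_cart less_eq_vec_def)
    ultimately show "?P ?h"
      using volume_preserving[OF h] by blast
  qed
  then show ?thesis using assms(2) by blast
qed

text \<open>The ellipsoid is the image of a ball under the matrix \<open>B\<close> of
  \<open>pos_def_congruent_identity\<close>, and \<open>\<bar>det B\<bar> = 1 / sqrt (det A)\<close>.\<close>

lemma emeasure_ellipsoid:
  fixes A :: "real^'k^'k"
  assumes "pos_def A" "0 \<le> t"
  shows "emeasure lborel {x. sqrt (x \<bullet> (A *v x)) \<le> t}
    = ennreal (unit_ball_vol (real CARD('k)) / sqrt (det A) * t ^ CARD('k))"
    and "0 < det A"
proof -
  obtain B :: "real^'k^'k" where B: "transpose B ** A ** B = mat 1"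
    using pos_def_congruent_identity[OF assms(1)] .
  have "det (transpose B ** A ** B) = det A * (det B)\<^sup>2"
    by (simp add: det_mul det_transpose power2_eq_square)
  then have det: "det A * (det B)\<^sup>2 = 1"
    using B by simp
  then show det_pos: "0 < det A"
    by (metis zero_less_mult_iff zero_less_one zero_le_power2 not_less)
  have detB: "\<bar>det B\<bar> = 1 / sqrt (det A)"
    using arg_cong[OF det, of sqrt] det_pos by (simp add: real_sqrt_mult field_simps)
  have form: "(B *v w) \<bullet> (A *v (B *v w)) = w \<bullet> w" for w
  proof -
    have "(B *v w) \<bullet> (A *v (B *v w)) = w \<bullet> ((transpose B ** A ** B) *v w)"
      by (simp add: matrix_vector_mul_assoc[symmetric] dot_lmul_matrix[symmetric]
          vector_transpose_matrix del: transpose_matrix_vector)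
    then show ?thesis by (simp add: B)
  qed
  have surj: "surj ((*v) B)"
  proof -
    have "det B \<noteq> 0" using det by auto
    then have "B ** matrix_inv B = mat 1"
      by (simp add: matrix_inv_mult invertible_det_nz)
    then show ?thesis
      by (metis matrix_right_invertible_surjective)
  qed
  have eq: "{x. sqrt (x \<bullet> (A *v x)) \<le> t} = (*v) B ` cball 0 t"
  proof (intro equalityI subsetI)
    fix x assume "x \<in> {x. sqrt (x \<bullet> (A *v x)) \<le> t}"
    moreover obtain w where "x = B *v w"
      using surj by (auto simp: surj_def)
    ultimately show "x \<in> (*v) B ` cball 0 t"
      by (simp only: mem_Collect_eq form) (simp add: norm_eq_sqrt_inner)
  next
    fix x assume "x \<in> (*v) B ` cball 0 t"
    then obtain w where "norm w \<le> t" "x = B *v w"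
      by auto
    then show "x \<in> {x. sqrt (x \<bullet> (A *v x)) \<le> t}"
      by (simp only: mem_Collect_eq form) (simp add: norm_eq_sqrt_inner)
  qed
  have lm: "(*v) B ` cball 0 t \<in> lmeasurable"
    "measure lebesgue ((*v) B ` cball 0 t) = \<bar>det B\<bar> * measure lebesgue (cball (0::real^'k) t)"
    using measure_linear_image_cart[of "(*v) B" "cball 0 t"] by auto
  have borel: "(*v) B ` cball 0 t \<in> sets borel"
    by (intro borel_compact compact_continuous_image linear_continuous_on)
      (auto simp: linear_conv_bounded_linear[symmetric])
  have "emeasure lborel ((*v) B ` cball 0 t) = emeasure lebesgue ((*v) B ` cball 0 t)"
    using borel by simp
  also have "\<dots> = ennreal (\<bar>det B\<bar> * measure lebesgue (cball (0::real^'k) t))"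
    using lm by (metis emeasure_eq_measure2)
  also have "\<dots> = ennreal (unit_ball_vol (real CARD('k)) / sqrt (det A) * t ^ CARD('k))"
    using assms(2) by (simp add: content_cball detB)
  finally show "emeasure lborel {x. sqrt (x \<bullet> (A *v x)) \<le> t}
    = ennreal (unit_ball_vol (real CARD('k)) / sqrt (det A) * t ^ CARD('k))"
    by (simp add: eq)
qed

section \<open>Integrals of functions of a quadratic form\<close>

text \<open>If the sublevel sets of \<open>q\<close> have volume \<open>c * t ^ d\<close>, then differentiating in
  \<open>t\<close> gives the density of the values of \<open>q\<close>. This is integration in polar coordinates in the form
  that needs only the volume of balls, not a surface measure.\<close>

lemma distr_power_volume_growth:
  fixes q :: "'a \<Rightarrow> real" and c :: real and d :: nat
  assumes q [measurable]: "q \<in> borel_measurable M" and q_nonneg: "\<And>x. x \<in> space M \<Longrightarrow> 0 \<le> q x"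
    and "0 \<le> c" "0 < d"
    and growth: "\<And>t. 0 \<le> t \<Longrightarrow> emeasure M {x \<in> space M. q x \<le> t} = ennreal (c * t ^ d)"
  shows "distr M borel q =
    density lborel (\<lambda>u. ennreal (indicator {0..} u * (c * (real d * u ^ (d - 1)))))" (is "?M = ?N")
proof -
  have eq: "emeasure ?M {..t} = ennreal (if 0 \<le> t then c * t ^ d else 0)" for t
  proof -
    have "emeasure ?M {..t} = emeasure M {x \<in> space M. q x \<le> t}"
      by (subst emeasure_distr) (auto intro!: arg_cong2[where f=emeasure])
    moreover have "{x \<in> space M. q x \<le> t} = {}" if "t < 0"
      using q_nonneg that by force
    ultimately show ?thesis using growth[of t] by (cases "0 \<le> t") auto
  qed
  have eq': "emeasure ?N {..t} = ennreal (if 0 \<le> t then c * t ^ d else 0)" for t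
  proof -
    have "emeasure ?N {..t} = (\<integral>\<^sup>+u. ennreal (c * (real d * u ^ (d - 1))) * indicator {0..t} u \<partial>lborel)"
      by (subst emeasure_density) (auto intro!: nn_integral_cong simp: indicator_def)
    also have "\<dots> = ennreal (if 0 \<le> t then c * t ^ d else 0)"
    proof (cases "0 \<le> t")
      case True
      have "(\<integral>\<^sup>+u. ennreal (c * (real d * u ^ (d - 1))) * indicator {0..t} u \<partial>lborel)
          = ennreal (c * t ^ d - c * 0 ^ d)"
        using True \<open>0 \<le> c\<close> by (intro nn_integral_FTC_Icc) (auto intro!: derivative_eq_intros)
      then show ?thesis using True \<open>0 < d\<close> by (simp add: zero_power)
    qed simp
    finally show ?thesis .
  qed
  show ?thesis
  proof (rule measure_eqI_generator_eq)
    show "Int_stable (range (\<lambda>t::real. {..t}))"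
      by (auto simp: Int_stable_def)
    show "sets ?M = sigma_sets UNIV (range (\<lambda>t::real. {..t}))"
      "sets ?N = sigma_sets UNIV (range (\<lambda>t::real. {..t}))"
      by (simp_all add: borel_eq_atMost)
    show "range (\<lambda>n::nat. {..real n}) \<subseteq> range (\<lambda>t::real. {..t})" by auto
    show "(\<Union>n::nat. {..real n}) = UNIV"
      by (auto intro: real_arch_simple)
  qed (auto simp: eq eq' simp del: One_nat_def)
qed

text \<open>The value of \<open>sqrt (z \<bullet> (A *v z))\<close> is the radius of the ellipsoid of \<open>A\<close> through \<open>z\<close>, and
  both sides integrate \<open>F\<close> against the distribution of this radius under Lebesgue measure.\<close>

lemma integral_of_quadratic_form:
  fixes A :: "real^'k^'k" and F :: "real \<Rightarrow> real" and y :: "real^'k"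
  assumes A: "pos_def A" and [measurable]: "F \<in> borel_measurable borel"
  shows "(LINT x|lborel. F (sqrt ((y - x) \<bullet> (A *v (y - x)))))
    = real CARD('k) * unit_ball_vol (real CARD('k)) / sqrt (det A) *
      (LINT u:{0..}|lborel. F u * u ^ (CARD('k) - 1))"
proof -
  let ?d = "CARD('k)"
  define c where "c = unit_ball_vol (real ?d) / sqrt (det A)"
  define q where "q x = sqrt (x \<bullet> (A *v x))" for x
  have q [measurable]: "q \<in> borel_measurable borel"
    unfolding q_def[abs_def]
    by (intro borel_measurable_continuous_onI continuous_intros linear_continuous_on_compose[OF continuous_on_id])
      (auto intro: matrix_vector_mul_linear)
  have q_nonneg: "0 \<le> q x" for x
    using A by (cases "x = 0") (auto simp: q_def pos_def_def intro: less_imp_le)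
  have "0 \<le> c"
    using emeasure_ellipsoid(2)[OF A order_refl] by (simp add: c_def)
  have distr: "distr lborel borel q =
      density lborel (\<lambda>u. ennreal (indicator {0..} u * (c * (real ?d * u ^ (?d - 1)))))"
  proof (rule distr_power_volume_growth)
    show "emeasure lborel {x \<in> space lborel. q x \<le> t} = ennreal (c * t ^ ?d)" if "0 \<le> t" for t
      using emeasure_ellipsoid(1)[OF A that] by (simp add: q_def c_def)
  qed (use \<open>0 \<le> c\<close> q_nonneg in auto)
  have even: "q (y - x) = q (- y + x)" for x
  proof -
    have "- y + x = - (y - x)" by simp
    then show ?thesis
      by (metis (no_types, lifting) inner_minus_left inner_minus_right minus_minus q_def
          linear_neg matrix_vector_mul_linear)
  qed
  have "(LINT x|lborel. F (q (y - x))) = (LINT x|distr lborel borel ((+) (- y)). F (q x))"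
    by (subst integral_distr) (simp_all add: even)
  also have "\<dots> = (LINT u|distr lborel borel q. F u)"
    by (simp add: lborel_distr_plus integral_distr)
  also have "\<dots> = (LINT u|lborel. (indicator {0..} u * (c * (real ?d * u ^ (?d - 1)))) *\<^sub>R F u)"
    unfolding distr using \<open>0 \<le> c\<close>
    by (intro integral_density) (auto simp: indicator_def)
  also have "\<dots> = (LINT u|lborel. real ?d * c * (indicator {0..} u * (F u * u ^ (?d - 1))))"
    by (intro Bochner_Integration.integral_cong) auto
  also have "\<dots> = real ?d * c * (LINT u:{0..}|lborel. F u * u ^ (?d - 1))"
    by (simp add: set_lebesgue_integral_def)
  finally show ?thesis
    by (simp add: q_def c_def)
qed

text \<open>The numerator is the area \<open>2 * pi powr (d / 2) / Gamma (d / 2)\<close> of the unit sphere; the denominator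
  is the constant of the standard normal density in dimension \<open>d\<close>.\<close>

lemma sphere_area_normalized:
  fixes d :: nat
  assumes "0 < d"
  shows "real d * unit_ball_vol (real d) / (2 * pi) powr (real d / 2)
    = 2 * 2 powr (- (real d / 2)) / Gamma (real d / 2)"
proof -
  have "real d / 2 \<notin> \<int>\<^sub>\<le>\<^sub>0"
    using assms by (simp add: nonpos_Ints_def)
  then have "Gamma (real d / 2 + 1) = real d / 2 * Gamma (real d / 2)"
    by (rule Gamma_plus1)
  moreover have "0 < Gamma (real d / 2)"
    using assms by (intro Gamma_real_pos) simp
  ultimately have area: "real d * unit_ball_vol (real d) = 2 * pi powr (real d / 2) / Gamma (real d / 2)"
    using assms by (simp only: unit_ball_vol_def) simp
  have two_pi: "(2 * pi) powr (real d / 2) = 2 powr (real d / 2) * pi powr (real d / 2)"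
    by (rule powr_mult)
  have cancel: "2 * p / G / (b * p) = 2 * inverse b / G" if "p \<noteq> 0" for p b G :: real
    using that by (simp add: divide_inverse)
  show ?thesis
    unfolding area two_pi powr_minus by (rule cancel) simp
qed

section \<open>The false alarm density\<close>

theorem theorem4:
  fixes X :: "(real^'d) set" and s :: "real^'d \<Rightarrow> real^'n" and Cov :: "real^'n^'n"
    and a0 :: real and a cost nu :: "real^'d \<Rightarrow> real" and x' :: "real^'d"
  assumes X_open: "open X"
    and Cov_pos_def: "pos_def Cov"
    and s_smooth: "smooth_on X s"
    and s_nonzero: "\<And>x. x \<in> X \<Longrightarrow> s x \<noteq> 0"
    and a0_prob: "0 < a0" "a0 \<le> 1"
    and a_density: "set_integrable lborel X a" "\<And>x. x \<in> X \<Longrightarrow> 0 < a x"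
    and cost_pos: "\<And>x. x \<in> X \<Longrightarrow> 0 < cost x"
    and curvature_pos_def: "\<And>x. x \<in> X \<Longrightarrow> pos_def (curvature s Cov x)"
    and x'_in: "x' \<in> X"
    and nu_density: "false_alarm_density X s Cov a0 a cost nu"
    and high_snr: "nu x' = snr s Cov x' ^ CARD('d) / volume_scale s Cov x' *
      (LINT x|lborel. (LINT l:{threshold s Cov a0 a cost x'..}|lborel.
         exp (- l) * peak_density s Cov l x' x))"
  shows "nu x' =
    2 * 2 powr (- (real CARD('d) / 2)) / Gamma (real CARD('d) / 2) *
    (snr s Cov x' ^ CARD('d) / volume_scale s Cov x') *
    exp (- (zeta_par s Cov x' * (snr s Cov x')\<^sup>2 / 2)) *
    (LINT u:{0..}|lborel. gauss_tail (scaled_threshold s Cov a0 a cost x' u) *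
       exp (- u\<^sup>2) * u ^ (CARD('d) - 1))"
proof -
  define r where "r = snr s Cov x'"
  define \<gamma> where "\<gamma> = gamma_par s Cov x'"
  define \<zeta> where "\<zeta> = zeta_par s Cov x'"
  define Q where "Q = Qmat s Cov x'"
  define \<tau> where "\<tau> = threshold s Cov a0 a cost x'"
  \<comment> \<open>The standard deviation of the peak log-likelihood value.\<close>
  define \<sigma> where "\<sigma> = r / sqrt (1 + \<gamma>)"
  define A where "A = r\<^sup>2 *\<^sub>R Q"
  \<comment> \<open>The normalized distance of the signal from the peak, which becomes the variable \<open>u\<close> of the result.\<close>
  define q where "q x = sqrt ((x' - x) \<bullet> (A *v (x' - x)))" for x
  define G where "G u = gauss_tail (scaled_threshold s Cov a0 a cost x' u)" for u
  define K where "K = r ^ CARD('d) * sqrt (det Q) / (2 * pi) powr (real CARD('d) / 2)"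
  have "0 < r"
    using pos_def_matrix_inv_pos[OF Cov_pos_def s_nonzero[OF x'_in]] by (simp add: r_def snr_def)
  have "0 \<le> \<gamma>" and \<zeta>: "\<zeta> = \<gamma> / (1 + \<gamma>)"
    using rank_one_update_inverse_form[OF curvature_pos_def[OF x'_in]]
    by (auto simp: \<gamma>_def \<zeta>_def gamma_par_def zeta_par_def Qmat_def)
  have "0 < \<sigma>" and \<sigma>2: "\<sigma>\<^sup>2 = r\<^sup>2 / (1 + \<gamma>)"
    using \<open>0 < r\<close> \<open>0 \<le> \<gamma>\<close> by (auto simp: \<sigma>_def power_divide)
  have Q: "pos_def Q"
    unfolding Q_def Qmat_def by (rule pos_def_rank_one_update[OF curvature_pos_def[OF x'_in]])
  then have A: "pos_def A"
    using \<open>0 < r\<close>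
    by (auto simp: A_def pos_def_def scaleR_matrix_vector_assoc[symmetric] transpose_scalar)
  have q2: "displacement_par s Cov x' x = (q x)\<^sup>2 / 2" for x
  proof -
    have "0 \<le> (x' - x) \<bullet> (A *v (x' - x))"
      using A by (cases "x' - x = 0") (auto simp: pos_def_def intro: less_imp_le)
    then show ?thesis
      by (simp add: displacement_par_def q_def A_def r_def Q_def)
  qed
  \<comment> \<open>One factor \<open>exp (- (q x)\<^sup>2 / 2)\<close> comes from the tilted peak value density, whose mean exceeds
    \<open>r\<^sup>2 / 2\<close> by \<open>(q x)\<^sup>2 / 2\<close>; the other comes from the peak location density.\<close>
  have inner: "(LINT l:{\<tau>..}|lborel. exp (- l) * peak_density s Cov l x' x)
      = K * exp (- (\<zeta> * r\<^sup>2 / 2)) * (G (q x) * exp (- (q x)\<^sup>2))" for x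
  proof -
    let ?b = "(q x)\<^sup>2 / 2"
    define \<mu> where "\<mu> = r\<^sup>2 / 2 + ?b"
    have "peak_density s Cov l x' x = 1 / (sqrt (2 * pi) * \<sigma>) *
        exp (- (1 / (2 * \<sigma>\<^sup>2)) * (l - \<mu>)\<^sup>2) * (K * exp (- ?b))" for l
      unfolding peak_density_def peak_value_density_def peak_location_density_def q2
      using \<open>0 < r\<close> \<open>0 \<le> \<gamma>\<close>
      by (simp add: K_def \<sigma>2 \<mu>_def r_def[symmetric] \<gamma>_def[symmetric] Q_def[symmetric])
        (simp add: \<sigma>_def algebra_simps)
    then have "(LINT l:{\<tau>..}|lborel. exp (- l) * peak_density s Cov l x' x)
        = K * exp (- ?b) * (LINT l:{\<tau>..}|lborel. exp (- l) * (1 / (sqrt (2 * pi) * \<sigma>) *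
          exp (- (1 / (2 * \<sigma>\<^sup>2)) * (l - \<mu>)\<^sup>2)))"
      by (subst set_integral_mult_right[symmetric]) (simp add: mult_ac)
    also have "\<dots> = K * exp (- ?b) * (exp (\<sigma>\<^sup>2 / 2 - \<mu>) * gauss_tail ((\<tau> - (\<mu> - \<sigma>\<^sup>2)) / \<sigma>))"
      by (simp only: exp_normal_tail_integral[OF \<open>0 < \<sigma>\<close>])
    also have "(\<tau> - (\<mu> - \<sigma>\<^sup>2)) / \<sigma> = scaled_threshold s Cov a0 a cost x' (q x)"
    proof -
      have "\<mu> - \<sigma>\<^sup>2 = 1 / 2 * ((\<gamma> - 1) / (\<gamma> + 1)) * r\<^sup>2 + ?b"
        using \<open>0 \<le> \<gamma>\<close> by (simp add: \<mu>_def \<sigma>2 field_simps)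
      then show ?thesis
        by (simp add: scaled_threshold_def \<sigma>_def r_def \<gamma>_def \<tau>_def)
    qed
    also have "\<sigma>\<^sup>2 / 2 - \<mu> = - (\<zeta> * r\<^sup>2 / 2) + - ?b"
      using \<open>0 \<le> \<gamma>\<close> by (simp add: \<mu>_def \<sigma>2 \<zeta> field_simps)
    also have "K * exp (- ?b) * (exp (- (\<zeta> * r\<^sup>2 / 2) + - ?b) *
        gauss_tail (scaled_threshold s Cov a0 a cost x' (q x)))
      = K * exp (- (\<zeta> * r\<^sup>2 / 2)) * (G (q x) * (exp (- ?b) * exp (- ?b)))"
      unfolding exp_add G_def by (simp only: mult_ac)
    also have "exp (- ?b) * exp (- ?b) = exp (- (q x)\<^sup>2)"
      by (simp add: exp_add[symmetric])
    finally show ?thesis .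
  qed
  have G [measurable]: "G \<in> borel_measurable borel"
    unfolding G_def[abs_def] scaled_threshold_def by measurable
  have "(LINT x|lborel. (LINT l:{\<tau>..}|lborel. exp (- l) * peak_density s Cov l x' x))
      = K * exp (- (\<zeta> * r\<^sup>2 / 2)) * (LINT x|lborel. G (q x) * exp (- (q x)\<^sup>2))"
    by (simp add: inner)
  also have "(LINT x|lborel. G (q x) * exp (- (q x)\<^sup>2))
      = real CARD('d) * unit_ball_vol (real CARD('d)) / sqrt (det A) *
        (LINT u:{0..}|lborel. G u * exp (- u\<^sup>2) * u ^ (CARD('d) - 1))"
    unfolding q_def by (rule integral_of_quadratic_form[OF A]) measurable
  finally have outer: "(LINT x|lborel. (LINT l:{\<tau>..}|lborel. exp (- l) * peak_density s Cov l x' x))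
      = K / sqrt (det A) * (real CARD('d) * unit_ball_vol (real CARD('d))) * exp (- (\<zeta> * r\<^sup>2 / 2)) *
        (LINT u:{0..}|lborel. G u * exp (- u\<^sup>2) * u ^ (CARD('d) - 1))"
    by simp
  \<comment> \<open>The volume of the ellipsoids of \<open>A\<close> cancels the normalization of the peak location density.\<close>
  have "sqrt (det A) = r ^ CARD('d) * sqrt (det Q)"
    using \<open>0 < r\<close>
    by (simp add: A_def det_scaleR_matrix real_sqrt_mult power_mult[symmetric] mult.commute
        real_sqrt_power[symmetric] power2_eq_square real_sqrt_power)
  moreover have "0 < det Q"
    using emeasure_ellipsoid(2)[OF Q order_refl] .
  ultimately have "K / sqrt (det A) = 1 / (2 * pi) powr (real CARD('d) / 2)"
    using \<open>0 < r\<close> by (simp add: K_def)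
  then have coeff: "K / sqrt (det A) * (real CARD('d) * unit_ball_vol (real CARD('d)))
      = 2 * 2 powr (- (real CARD('d) / 2)) / Gamma (real CARD('d) / 2)"
    using sphere_area_normalized[of "CARD('d)"] by simp
  show ?thesis
    unfolding high_snr r_def[symmetric] \<zeta>_def[symmetric] \<tau>_def[symmetric] G_def[symmetric] outer coeff
    by (simp only: mult_ac)
qed

end
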